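(* For every integer $n\geqslant 2$ and every tuple $\mathbf{m}=(m_1,\ldots,m_n)$ of positive integers there exist positive real constants $\tilde C_1(\mathbf{m},n)$ and $\tilde C_2(\mathbf{m},n)$, depending only on $n$ and $\mathbf{m}$, such that the following holds. Let $t$ be a positive integer, let $G=\{x\in\mathbb{C}\mid x^t=1\}\subset\mathbb{C}^*$, let $G_1,\ldots,G_n$ be cosets of $G$ in $\mathbb{C}^*$, and let $f_1(x),\ldots,f_n(x)\in\mathbb{C}[x]$ be an admissible set of polynomials with $\deg f_i=m_i$ for $i=1,\ldots,n$. Suppose that $$|G|>\tilde C_1(\mathbf{m},n).$$ Then the set $$M=\{x\in\mathbb{C}\mid f_i(x)\in G_i,\ i=1,\ldots,n\}$$ satisfies $$|M|\leqslant \tilde C_2(\mathbf{m},n)\,|G|^{\frac12+\frac1{2n}}.$$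
   Context: A set (tuple) of polynomials $f_1(x),\ldots,f_n(x)\in\mathbb{C}[x]$ is called admissible if there exist $x_1,\ldots,x_n\in\mathbb{C}$ such that $f_i(x_i)=0$ and $f_j(x_i)\neq 0$ for all $1\leqslant i,j\leqslant n$ with $j\neq i$, and moreover $f_i(0)\neq 0$ for $i=1,\ldots,n$. *)

theory Defs
  imports Complex_Main "HOL-Computational_Algebra.Polynomial"
begin

definition admissible :: "nat \<Rightarrow> (nat \<Rightarrow> complex poly) \<Rightarrow> bool" where
  "admissible n f \<longleftrightarrow>
     (\<exists>x :: nat \<Rightarrow> complex.
        (\<forall>i\<in>{1..n}. poly (f i) (x i) = 0) \<and>
        (\<forall>i\<in>{1..n}. \<forall>j\<in>{1..n}. j \<noteq> i \<longrightarrow> poly (f j) (x i) \<noteq> 0)) \<and>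
     (\<forall>i\<in>{1..n}. poly (f i) 0 \<noteq> 0)"

definition unity_roots :: "nat \<Rightarrow> complex set" where
  "unity_roots t = {x. x ^ t = 1}"

text \<open>Cosets in the multiplicative group of nonzero complex numbers, hence \<open>g \<noteq> 0\<close>.\<close>

definition is_mult_coset :: "complex set \<Rightarrow> complex set \<Rightarrow> bool" where
  "is_mult_coset G H \<longleftrightarrow> (\<exists>g. g \<noteq> 0 \<and> H = (\<lambda>x. g * x) ` G)"

end

theory Submission
  imports Defs "Jordan_Normal_Form.Determinant"
begin

text \<open>
  If \<open>f\<^sub>i(x)\<close> lies in a coset \<open>g\<^sub>i G\<close> of a group of roots of unity, then
  \<open>f\<^sub>i(x) f\<^sub>i\<^sup>*(w) = |g\<^sub>i|\<^sup>2\<close> for \<open>w = cnj x\<close>, where \<open>f\<^sup>*\<close> has the conjugated coefficients.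
  Using only \<open>i = 1, 2\<close>, the point \<open>x\<close> is therefore a root of the resultant with respect to \<open>w\<close>
  of \<open>f\<^sub>1(z) f\<^sub>1\<^sup>*(w) - |g\<^sub>1|\<^sup>2\<close> and \<open>f\<^sub>2(z) f\<^sub>2\<^sup>*(w) - |g\<^sub>2|\<^sup>2\<close>. This is a polynomial in \<open>z\<close> of
  degree bounded in terms of the \<open>m\<^sub>i\<close>. It does not vanish at a root \<open>a\<close> of \<open>f\<^sub>1\<close> with
  \<open>f\<^sub>2(a) \<noteq> 0\<close>: there the first polynomial is a nonzero constant and the second one keeps its
  degree, so the Sylvester matrix is triangular with nonzero diagonal.
  Hence \<open>|M|\<close> is even bounded independently of \<open>G\<close>.
\<close>

text \<open>Pairs a Sylvester row, a shifted polynomial, with the vector of powers of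
  \<open>w\<close>; the degree bound ensures that \<open>N\<close> columns hold all its
  coefficients.\<close>

lemma sum_coeff_monom_mult:
  fixes p :: "'a::comm_semiring_1 poly"
  assumes "degree p + i < N"
  shows "(\<Sum>j<N. coeff (monom 1 i * p) j * w ^ j) = w ^ i * poly p w"
proof -
  have deg: "degree (monom 1 i * p) < N"
    using degree_mult_le[of "monom 1 i" p] degree_monom_le[of "1::'a" i] assms by linarith
  have "(\<Sum>j<N. coeff (monom 1 i * p) j * w ^ j)
      = (\<Sum>j\<le>degree (monom 1 i * p). coeff (monom 1 i * p) j * w ^ j)"
    using deg by (intro sum.mono_neutral_right) (auto simp: coeff_eq_0)
  also have "\<dots> = poly (monom 1 i * p) w"
    by (simp add: poly_altdef)
  finally show ?thesis
    by (simp add: poly_monom)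
qed

text \<open>
  The Sylvester matrix is written with ascending powers of the main variable along the columns,
  which makes it lower triangular at the specialisation \<open>a\<close>.
\<close>

lemma card_common_roots_le:
  fixes P Q :: "'a::field poly poly"
  assumes degP: "degree P \<le> m" and degQ: "degree Q \<le> n" and n: "n > 0"
    and dP: "\<And>k. degree (coeff P k) \<le> d" and dQ: "\<And>k. degree (coeff Q k) \<le> d"
    and P0: "poly (coeff P 0) a \<noteq> 0" and Pk: "\<And>k. k > 0 \<Longrightarrow> poly (coeff P k) a = 0"
    and Qn: "poly (coeff Q n) a \<noteq> 0"
  defines "Z \<equiv> {z. \<exists>w. poly (map_poly (\<lambda>q. poly q z) P) w = 0
                   \<and> poly (map_poly (\<lambda>q. poly q z) Q) w = 0}"
  shows "finite Z \<and> card Z \<le> d * (m + n)"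
proof -
  define N where "N = m + n"
  define row where "row i = (if i < n then monom 1 i * P else monom 1 (i - n) * Q)" for i
  define A where "A = mat N N (\<lambda>(i, j). coeff (row i) j)"
  define ev where "ev z = map_mat (\<lambda>q. poly q z) A" for z
  have A: "A \<in> carrier_mat N N"
    by (simp add: A_def)
  have ev_carrier: "ev z \<in> carrier_mat N N" for z
    by (simp add: ev_def A_def)
  have det_ev: "det (ev z) = poly (det A) z" for z
  proof -
    interpret h: comm_ring_hom "\<lambda>q. poly q z"
      by unfold_locales auto
    show ?thesis
      unfolding ev_def by (rule h.hom_det)
  qed
  have degA: "degree (det A) \<le> d * N"
    by (rule degree_det_le[OF _ A]) (auto simp: A_def row_def coeff_monom_mult dP dQ)
  have "det (ev a) \<noteq> 0"
  proof -
    \<comment> \<open>At \<open>a\<close> a row from \<open>P\<close> keeps only its diagonal entry,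
      while row \<open>i\<close> from \<open>Q\<close> is shifted by \<open>i - n\<close> and so has
      degree at most \<open>i\<close>.\<close>
    have "ev a $$ (i, j) = 0" if "i < j" "j < N" for i j
      using that degQ by (auto simp: ev_def A_def row_def coeff_monom_mult Pk coeff_eq_0)
    then have "det (ev a) = prod_list (diag_mat (ev a))"
      by (rule det_lower_triangular[OF _ ev_carrier])
    moreover have "ev a $$ (i, i) \<noteq> 0" if "i < N" for i
      using that n by (auto simp: ev_def A_def row_def coeff_monom_mult P0 Qn)
    ultimately show ?thesis
      using ev_carrier[of a] by (auto simp: diag_mat_def)
  qed
  then have nz: "det A \<noteq> 0"
    using det_ev[of a] by auto
  have "Z \<subseteq> {z. poly (det A) z = 0}"
  proof
    fix z assume "z \<in> Z"
    then obtain w where w: "poly (map_poly (\<lambda>q. poly q z) P) w = 0"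
        "poly (map_poly (\<lambda>q. poly q z) Q) w = 0"
      by (auto simp: Z_def)
    \<comment> \<open>The powers of a common root \<open>w\<close> form a kernel vector; its entry
      at index 0 is 1, so it is nonzero even when \<open>w = 0\<close>.\<close>
    define v where "v = vec N (\<lambda>j. w ^ j)"
    have "v $ 0 \<noteq> 0\<^sub>v N $ 0"
      using n by (simp add: v_def N_def)
    then have v0: "v \<noteq> 0\<^sub>v N"
      by auto
    have coeff_ev: "poly (coeff (monom 1 i * R) j) z
        = coeff (monom 1 i * map_poly (\<lambda>q. poly q z) R) j" for i j and R :: "'a poly poly"
      by (simp add: coeff_monom_mult coeff_map_poly)
    have "ev z *\<^sub>v v = 0\<^sub>v N"
    proof (rule eq_vecI)
      fix i assume "i < dim_vec (0\<^sub>v N :: 'a vec)"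
      then have i: "i < N" by simp
      have "(ev z *\<^sub>v v) $ i = (\<Sum>j<N. poly (coeff (row i) j) z * w ^ j)"
        using i by (simp add: ev_def A_def v_def scalar_prod_def lessThan_atLeast0)
      also have "\<dots> = 0"
      proof (cases "i < n")
        case True
        have "degree (map_poly (\<lambda>q. poly q z) P) + i < N"
          using map_poly_degree_leq[of "\<lambda>q. poly q z" P] degP True by (simp add: N_def)
        from sum_coeff_monom_mult[OF this, of w] show ?thesis
          using True w by (simp add: row_def coeff_ev)
      next
        case False
        have "degree (map_poly (\<lambda>q. poly q z) Q) + (i - n) < N"
          using map_poly_degree_leq[of "\<lambda>q. poly q z" Q] degQ False i by (simp add: N_def)
        from sum_coeff_monom_mult[OF this, of w] show ?thesis
          using False w by (simp add: row_def coeff_ev)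
      qed
      finally show "(ev z *\<^sub>v v) $ i = 0\<^sub>v N $ i"
        using i by simp
    qed (simp add: ev_def A_def)
    then have "det (ev z) = 0"
      using det_0_iff_vec_prod_zero[OF ev_carrier[of z]] v0 by (metis v_def vec_carrier)
    then show "z \<in> {z. poly (det A) z = 0}"
      by (simp add: det_ev)
  qed
  moreover have "finite {z. poly (det A) z = 0}"
    using nz by (rule poly_roots_finite)
  moreover have "card {z. poly (det A) z = 0} \<le> d * N"
    using card_poly_roots_bound[OF nz] degA by linarith
  ultimately show ?thesis
    unfolding N_def by (meson card_mono finite_subset le_trans)
qed

lemma card_product_curves_inter_le:
  fixes f1 f2 g1 g2 :: "'a::field poly" and c1 c2 :: 'a
  assumes a: "poly f1 a = 0" "poly f2 a \<noteq> 0" and c1: "c1 \<noteq> 0"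
    and deg: "degree f1 = m1" "degree f2 = m2" "degree g1 = m1" "degree g2 = m2" and "m2 > 0"
  defines "Z \<equiv> {z. \<exists>w. poly f1 z * poly g1 w = c1 \<and> poly f2 z * poly g2 w = c2}"
  shows "finite Z \<and> card Z \<le> (m1 + m2)\<^sup>2"
proof -
  \<comment> \<open>This is f(z) g(w) - c with \<open>w\<close> as the outer variable and
    coefficients that are polynomials in z.\<close>
  define R where "R f g c = Polynomial.smult f (map_poly (\<lambda>x. [:x:]) g) - [:[:c:]:]"
    for f g :: "'a poly" and c
  have coeff_R: "coeff (R f g c) k = Polynomial.smult (coeff g k) f - (if k = 0 then [:c:] else 0)"
    for f g c k
    by (cases k) (simp_all add: R_def coeff_map_poly)
  have degree_R: "degree (R f g c) \<le> degree g" for f g c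
    by (intro degree_le) (auto simp: coeff_R coeff_eq_0)
  have degree_coeff_R: "degree (coeff (R f g c) k) \<le> degree f" for f g c k
    by (auto simp: coeff_R degree_smult_le intro!: degree_diff_le)
  have "map_poly (\<lambda>q. poly q z) (R f g c) = Polynomial.smult (poly f z) g - [:c:]" for f g c z
    by (rule poly_eqI) (auto simp: coeff_map_poly coeff_R coeff_pCons split: nat.split)
  then have Z: "Z = {z. \<exists>w. poly (map_poly (\<lambda>q. poly q z) (R f1 g1 c1)) w = 0
                   \<and> poly (map_poly (\<lambda>q. poly q z) (R f2 g2 c2)) w = 0}"
    by (simp add: Z_def)
  have "g2 \<noteq> 0"
    using deg \<open>m2 > 0\<close> by auto
  then have "coeff g2 m2 \<noteq> 0"
    by (metis deg(4) leading_coeff_0_iff)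
  \<comment> \<open>The crude common bound \<open>d = m1 + m2\<close> on the degrees in z yields the
    square. As \<open>m2 > 0\<close>, subtracting \<open>c2\<close> leaves the coefficient of index
    \<open>m2\<close> untouched.\<close>
  then have "finite Z \<and> card Z \<le> (m1 + m2) * (m1 + m2)"
    unfolding Z using a c1 \<open>m2 > 0\<close> degree_R[of f1 g1] degree_R[of f2 g2]
      degree_coeff_R[of f1 g1 c1] degree_coeff_R[of f2 g2 c2]
    by (intro card_common_roots_le[where a = a]) (auto simp: coeff_R deg trans_le_add1 trans_le_add2)
  then show ?thesis
    by (simp add: power2_eq_square)
qed

text \<open>Roots of unity have norm 1, so every element of the coset of \<open>g\<close> has
  squared norm \<open>g * cnj g\<close>.\<close>

lemma mult_cnj_in_coset_unity_roots:
  assumes "is_mult_coset (unity_roots t) H" "t > 0"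
  obtains c where "c \<noteq> 0" "\<And>y. y \<in> H \<Longrightarrow> y * cnj y = c"
proof -
  obtain g where g: "g \<noteq> 0" "H = (\<lambda>x. g * x) ` unity_roots t"
    using assms by (auto simp: is_mult_coset_def)
  have "x * cnj x = 1" if "x \<in> unity_roots t" for x
  proof -
    have "norm x ^ t = 1"
      using that by (simp add: unity_roots_def flip: norm_power)
    then have "norm x = 1"
      using \<open>t > 0\<close> power_eq_imp_eq_base[of "norm x" t 1] by simp
    then show ?thesis
      by (simp add: complex_norm_square[symmetric])
  qed
  then have "y * cnj y = g * cnj g" if "y \<in> H" for y
    using that g by (auto simp: algebra_simps)
  with g(1) show thesis
    by (intro that[of "g * cnj g"]) auto
qed

lemma degree_map_poly_cnj: "degree (map_poly cnj p) = degree p"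
  by (rule degree_map_poly) auto

theorem theorem3:
  fixes n :: nat and m :: "nat \<Rightarrow> nat"
  assumes "n \<ge> 2"
    and "\<And>i. i \<in> {1..n} \<Longrightarrow> m i > 0"
  shows "\<exists>C1 C2 :: real. C1 > 0 \<and> C2 > 0 \<and>
    (\<forall>(t :: nat) (G :: complex set) (H :: nat \<Rightarrow> complex set) (f :: nat \<Rightarrow> complex poly).
       t > 0 \<and> G = unity_roots t \<and>
       (\<forall>i\<in>{1..n}. is_mult_coset G (H i)) \<and>
       admissible n f \<and>
       (\<forall>i\<in>{1..n}. degree (f i) = m i) \<and>
       real (card G) > C1 \<longrightarrow>
       finite {x. \<forall>i\<in>{1..n}. poly (f i) x \<in> H i} \<and>
       real (card {x. \<forall>i\<in>{1..n}. poly (f i) x \<in> H i})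
         \<le> C2 * real (card G) powr (1 / 2 + 1 / (2 * real n)))"
proof -
  define B where "B = (m 1 + m 2)\<^sup>2"
  have key: "finite {x. \<forall>i\<in>{1..n}. poly (f i) x \<in> H i} \<and>
      card {x. \<forall>i\<in>{1..n}. poly (f i) x \<in> H i} \<le> B" (is "finite ?M \<and> _")
    if t: "t > 0" and H: "\<forall>i\<in>{1..n}. is_mult_coset (unity_roots t) (H i)"
      and adm: "admissible n f" and deg: "\<forall>i\<in>{1..n}. degree (f i) = m i" for t H f
  proof -
    have idx: "1 \<in> {1..n}" "2 \<in> {1..n}"
      using \<open>n \<ge> 2\<close> by auto
    obtain a where a: "poly (f 1) a = 0" "poly (f 2) a \<noteq> 0"
      using adm idx unfolding admissible_def by (metis numeral_eq_one_iff semiring_norm(85))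
    obtain c1 where c1: "c1 \<noteq> 0" "\<And>y. y \<in> H 1 \<Longrightarrow> y * cnj y = c1"
      using mult_cnj_in_coset_unity_roots H idx(1) t by blast
    obtain c2 where c2: "\<And>y. y \<in> H 2 \<Longrightarrow> y * cnj y = c2"
      using mult_cnj_in_coset_unity_roots H idx(2) t by blast
    \<comment> \<open>Freeing \<open>w\<close> from being the conjugate of \<open>z\<close> makes
      the conditions algebraic.\<close>
    define Z where "Z = {z. \<exists>w. poly (f 1) z * poly (map_poly cnj (f 1)) w = c1
                        \<and> poly (f 2) z * poly (map_poly cnj (f 2)) w = c2}"
    have Z: "finite Z \<and> card Z \<le> B"
      unfolding Z_def B_def using a c1(1) deg idx assms(2)
      by (intro card_product_curves_inter_le[where a = a]) (auto simp: degree_map_poly_cnj)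
    have "?M \<subseteq> Z"
    proof
      fix x assume "x \<in> ?M"
      \<comment> \<open>With \<open>w = cnj x\<close>, the polynomial with conjugated coefficients
        takes the conjugate value.\<close>
      then show "x \<in> Z"
        using c1(2) c2 idx unfolding Z_def
        by (auto intro!: exI[of _ "cnj x"])
    qed
    with Z show ?thesis
      by (meson card_mono finite_subset le_trans)
  qed
  have B: "real B > 0"
    using assms(2)[of 1] \<open>n \<ge> 2\<close> by (simp add: B_def)
  show ?thesis
  \<comment> \<open>The bound \<open>B\<close> is already free of \<open>t\<close>; above the
    threshold 1 every nonnegative power of |G| is at least 1.\<close>
  proof (rule exI[of _ 1], rule exI[of _ "real B"], intro conjI allI impI)
    fix t G H f
    assume *: "t > 0 \<and> G = unity_roots t \<and> (\<forall>i\<in>{1..n}. is_mult_coset G (H i)) \<and>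
       admissible n f \<and> (\<forall>i\<in>{1..n}. degree (f i) = m i) \<and> real (card G) > 1"
    then show "finite {x. \<forall>i\<in>{1..n}. poly (f i) x \<in> H i}"
      using key by blast
    have "card {x. \<forall>i\<in>{1..n}. poly (f i) x \<in> H i} \<le> B"
      using key * by blast
    then have "real (card {x. \<forall>i\<in>{1..n}. poly (f i) x \<in> H i}) \<le> real B * 1"
      unfolding mult_1_right of_nat_le_iff .
    also have "\<dots> \<le> real B * real (card G) powr (1 / 2 + 1 / (2 * real n))"
      using * by (intro mult_left_mono ge_one_powr_ge_zero) auto
    finally show "real (card {x. \<forall>i\<in>{1..n}. poly (f i) x \<in> H i})
         \<le> real B * real (card G) powr (1 / 2 + 1 / (2 * real n))" .
  qed (use B in auto)
qed

end
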